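(* Let $q=p^r$ be a prime power ($p$ any prime, $r\ge1$) and let $n\ge1$. Then $$F_q(n,0,0)=\frac1q\,\left|\left\{x\in\mathbb F_{q^n} : T_1(x^{q+1}-x^2)=0\right\}\right|.$$
   Context: For $a\in\mathbb F_{q^n}$ put $T_1(a)=\sum_{i=0}^{n-1}a^{q^i}$ and $T_2(a)=\sum_{0\le i<j\le n-1}a^{q^i+q^j}$ (an empty sum is $0$). For $t_1,t_2\in\mathbb F_q$, $F_q(n,t_1,t_2)$ is the number of $a\in\mathbb F_{q^n}$ with $T_1(a)=t_1$ and $T_2(a)=t_2$. *)

theory Defs
  imports Complex_Main "HOL-Library.Cardinality" "HOL-Computational_Algebra.Primes"
begin

(* The type 'a plays the role of the field with q^n elements. The field with q elements is
   its subfield {x. x ^ q = x}, so T1, T2 (which take values there) and the prescribed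
   values t1, t2 are all elements of 'a. *)

definition T1 :: "nat \<Rightarrow> nat \<Rightarrow> 'a::finite_field \<Rightarrow> 'a" where
  "T1 q n a = (\<Sum>i<n. a ^ (q ^ i))"

definition T2 :: "nat \<Rightarrow> nat \<Rightarrow> 'a::finite_field \<Rightarrow> 'a" where
  "T2 q n a = (\<Sum>(i, j) \<in> {(i, j). i < j \<and> j < n}. a ^ (q ^ i + q ^ j))"

(* The index set in T2 is finite, so the sum is never the default value for infinite sums. *)
lemma finite_T2_index: "finite {(i, j). i < j \<and> j < (n::nat)}"
  by (rule finite_subset[of _ "{..<n} \<times> {..<n}"]) auto

definition F :: "nat \<Rightarrow> nat \<Rightarrow> 'a::finite_field \<Rightarrow> 'a \<Rightarrow> nat" where
  "F q n t1 t2 = card {a. T1 q n a = t1 \<and> T2 q n a = t2}"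

end

theory Submission
  imports Defs "HOL-Number_Theory.Residues" "HOL-Computational_Algebra.Polynomial"
begin

text \<open>
  The elements of trace zero are exactly the \<open>x ^ q - x\<close> (additive Hilbert 90): the kernel of
  \<open>x \<mapsto> x ^ q - x\<close> has at most \<open>q\<close> elements, its image is contained in the kernel of the trace, which
  has at most \<open>q ^ (n - 1)\<close> elements, and the two bounds multiply to the order of the field, so
  both are attained. Moreover, with \<open>b i = x ^ q ^ i\<close>, the sum defining \<open>T2\<close> telescopes for
  \<open>b (i + 1) - b i\<close>, because \<open>b n = b 0\<close>, and gives \<open>T2 (x ^ q - x) = T1 (x ^ (q + 1) - x ^ 2)\<close>.
  Hence every element counted on the left has exactly \<open>q\<close> preimages on the right.
\<close>

lemma card_vimage_additive:
  fixes f :: "'a :: {ab_group_add, finite} \<Rightarrow> 'b :: ab_group_add"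
  assumes diff: "\<And>x y. f (x - y) = f x - f y" and S: "S \<subseteq> range f"
  shows "card (f -` S) = card S * card (f -` {0})"
proof -
  have fibre: "card (f -` {y}) = card (f -` {0})" if y: "y \<in> S" for y
  proof -
    obtain z where z: "y = f z" using subsetD[OF S y] by (rule imageE)
    have "f (x + z) = f x + f z" for x using diff[of "x + z" z] by simp
    hence "bij_betw (\<lambda>x. x + z) (f -` {0}) (f -` {y})"
      by (intro bij_betw_byWitness[where f' = "\<lambda>x. x - z"]) (auto simp: z diff)
    thus ?thesis by (simp add: bij_betw_same_card)
  qed
  have "finite S" by (rule finite_subset[OF S]) simp
  moreover have "f -` S = (\<Union>y\<in>S. f -` {y})" by auto
  ultimately have "card (f -` S) = (\<Sum>y\<in>S. card (f -` {y}))"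
    by (simp, intro card_UN_disjoint) auto
  thus ?thesis by (simp add: fibre)
qed

text \<open>With \<open>j\<close> as the outer index, the inner sum over \<open>i < j\<close>
  collapses to \<open>b j - b 0\<close>. The part containing the constant \<open>b 0\<close>
  telescopes again, to \<open>b 0 * (b n - b 0)\<close>, which vanishes by periodicity.\<close>

lemma sum_mult_pairs_telescope:
  fixes b :: "nat \<Rightarrow> 'a :: comm_ring_1"
  assumes "b n = b 0"
  shows "(\<Sum>(i, j) \<in> {(i, j). i < j \<and> j < n}. (b (Suc i) - b i) * (b (Suc j) - b j))
    = (\<Sum>j<n. b (Suc j) * b j - b j ^ 2)"
proof -
  have "(\<Sum>(i, j) \<in> {(i, j). i < j \<and> j < n}. (b (Suc i) - b i) * (b (Suc j) - b j))
      = (\<Sum>(j, i) \<in> Sigma {..<n} (\<lambda>j. {..<j}). (b (Suc i) - b i) * (b (Suc j) - b j))"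
    by (rule sum.reindex_bij_witness[of _ prod.swap prod.swap]) auto
  also have "\<dots> = (\<Sum>j<n. \<Sum>i<j. (b (Suc i) - b i) * (b (Suc j) - b j))"
    by (simp add: sum.Sigma)
  also have "\<dots> = (\<Sum>j<n. (b j - b 0) * (b (Suc j) - b j))"
    by (simp add: sum_distrib_right[symmetric] sum_lessThan_telescope)
  also have "\<dots> = (\<Sum>j<n. (b (Suc j) * b j - b j ^ 2) - b 0 * (b (Suc j) - b j))"
    by (intro sum.cong) (simp_all add: algebra_simps power2_eq_square)
  also have "\<dots> = (\<Sum>j<n. b (Suc j) * b j - b j ^ 2) - b 0 * (b n - b 0)"
    by (simp add: sum_subtractf[where g = "\<lambda>j. b 0 * (b (Suc j) - b j)"]
        sum_distrib_left[symmetric] sum_lessThan_telescope)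
  finally show ?thesis using assms by simp
qed

lemma CHAR_eq_of_CARD_prime_power:
  assumes "prime p" and "CARD('a::finite_field) = p ^ k"
  shows "CHAR('a) = p"
proof -
  have "CHAR('a) dvd p ^ k" using CHAR_dvd_CARD[where 'a = 'a] assms by simp
  hence "CHAR('a) dvd p" by (rule prime_dvd_power[OF CHAR_prime])
  thus ?thesis using assms by (simp add: primes_dvd_imp_eq)
qed

lemma diff_power_CHAR_power:
  fixes x y :: "'a::finite_field"
  shows "(x - y) ^ (CHAR('a) ^ k) = x ^ (CHAR('a) ^ k) - y ^ (CHAR('a) ^ k)"
  \<comment> \<open>Additivity is applied to \<open>(x - y) + y\<close>, which avoids computing a
    power of \<open>-1\<close>.\<close>
  using freshmans_dream'[of "CHAR('a) ^ k" k "x - y" y] by simp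

text \<open>The trace is a polynomial function of degree at most \<open>q ^ (n - 1)\<close>, so its
  zeros are bounded by that degree.\<close>

lemma card_T1_eq_0_le:
  assumes "q > 1" and "n > 0"
  shows "card {a::'a::finite_field. T1 q n a = 0} \<le> q ^ (n - 1)"
proof -
  define P :: "'a poly" where "P = (\<Sum>i<n. monom 1 (q ^ i))"
  \<comment> \<open>As \<open>q > 1\<close>, the exponents \<open>q ^ i\<close> are distinct, so
    only \<open>i = n - 1\<close> contributes to this coefficient.\<close>
  have "coeff P (q ^ (n - 1)) = (\<Sum>i<n. if i = n - 1 then 1 else 0)"
    unfolding P_def coeff_sum using assms by (intro sum.cong) auto
  also have "\<dots> = 1" using assms by simp
  finally have "P \<noteq> 0" by auto
  have "degree P \<le> q ^ (n - 1)" unfolding P_def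
  proof (rule degree_sum_le)
    fix i assume "i \<in> {..<n}"
    hence "i \<le> n - 1" by auto
    hence "q ^ i \<le> q ^ (n - 1)" using assms by (intro power_increasing) auto
    thus "degree (monom (1::'a) (q ^ i)) \<le> q ^ (n - 1)" by (simp add: degree_monom_eq)
  qed simp
  moreover have "{a. T1 q n a = 0} = {a. poly P a = 0}"
    by (simp add: T1_def P_def poly_sum poly_monom)
  ultimately show ?thesis using card_poly_roots_bound[OF \<open>P \<noteq> 0\<close>] by simp
qed

lemma card_power_eq_self_le:
  assumes "q > 1"
  shows "card {x::'a::idom. x ^ q - x = 0} \<le> q"
proof -
  define P :: "'a poly" where "P = monom 1 q - monom 1 1"
  have "coeff P q = 1" unfolding P_def using assms by simp
  hence "P \<noteq> 0" by auto
  moreover have "degree P \<le> q" unfolding P_def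
    using assms by (intro degree_diff_le) (simp_all add: degree_monom_eq)
  moreover have "{x. x ^ q - x = 0} = {x. poly P x = 0}"
    by (simp add: P_def poly_monom)
  ultimately show ?thesis using card_poly_roots_bound[of P] by simp
qed

context
  fixes k q n :: nat
  assumes q: "q = CHAR('a::finite_field) ^ k" and k: "k > 0" and n: "n > 0"
    and card: "CARD('a) = q ^ n"
begin

lemma q_gt_1: "q > 1"
  unfolding q by (rule one_less_power[OF prime_gt_1_nat[OF CHAR_prime] k])

lemma diff_power_q_power: "(x - y :: 'a) ^ (q ^ i) = x ^ (q ^ i) - y ^ (q ^ i)"
  using diff_power_CHAR_power[of x y "k * i"] by (simp only: q power_mult)

lemma conjugate_last: "(x::'a) ^ (q ^ n) = x"
  using finite_field_power_card_eq_same[of x] by (simp add: card)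

lemma conjugate_power_diff: "((x::'a) ^ q - x) ^ (q ^ i) = x ^ (q ^ Suc i) - x ^ (q ^ i)"
  by (simp add: diff_power_q_power flip: power_mult)

lemma T1_power_diff: "T1 q n ((x::'a) ^ q - x) = 0"
  unfolding T1_def conjugate_power_diff
  using sum_lessThan_telescope[of "\<lambda>i. x ^ (q ^ i)" n] by (simp only: conjugate_last) simp

lemma T2_power_diff: "T2 q n ((x::'a) ^ q - x) = T1 q n (x ^ (q + 1) - x ^ 2)"
proof -
  \<comment> \<open>The conjugates of \<open>x ^ (q + 1) - x ^ 2\<close> are exactly the summands
    left after telescoping with \<open>b j = x ^ (q ^ j)\<close>.\<close>
  have "(x ^ (q + 1) - x ^ 2) ^ (q ^ j) = x ^ (q ^ Suc j) * x ^ (q ^ j) - (x ^ (q ^ j)) ^ 2" for j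
    unfolding diff_power_q_power
    by (simp add: power_mult_distrib mult.commute flip: power_mult)
  thus ?thesis
    unfolding T1_def T2_def power_add[of "x ^ q - x"] conjugate_power_diff
    using sum_mult_pairs_telescope[of "\<lambda>i. x ^ (q ^ i)" n] by (simp add: conjugate_last)
qed

lemma power_diff_additive: "(x - y :: 'a) ^ q - (x - y) = (x ^ q - x) - (y ^ q - y)"
  using diff_power_q_power[of x y 1] by simp

lemma hilbert_90_additive:
  shows range_power_diff: "range (\<lambda>x::'a. x ^ q - x) = {a. T1 q n a = 0}"
    and card_kernel_power_diff: "card ((\<lambda>x::'a. x ^ q - x) -` {0}) = q"
proof -
  let ?f = "\<lambda>x::'a. x ^ q - x" and ?K = "{a::'a. T1 q n a = 0}"
  have q0: "q > 0" "q ^ (n - 1) > 0" using q_gt_1 by auto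
  have sub: "range ?f \<subseteq> ?K" using T1_power_diff by auto
  have ker: "card (?f -` {0}) \<le> q" using card_power_eq_self_le[OF q_gt_1] by (simp add: vimage_def)
  have K: "card ?K \<le> q ^ (n - 1)" using card_T1_eq_0_le[OF q_gt_1 n] .
  have im: "card (range ?f) \<le> q ^ (n - 1)" using card_mono[OF _ sub] K by simp
  \<comment> \<open>Taking the whole range as \<open>S\<close> turns the fibre count into image size
    times kernel size equals field size.\<close>
  have "?f -` range ?f = UNIV" by auto
  hence "card (range ?f) * card (?f -` {0}) = CARD('a)"
    using card_vimage_additive[of ?f "range ?f"] power_diff_additive by simp
  also have "\<dots> = q ^ (n - 1) * q" using n card by (simp add: power_eq_if)
  finally have eq: "card (range ?f) * card (?f -` {0}) = q ^ (n - 1) * q" .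
  \<comment> \<open>Replacing the image size by its upper bound and cancelling
    \<open>q ^ (n - 1)\<close> bounds the kernel from below.\<close>
  have "q ^ (n - 1) * q \<le> q ^ (n - 1) * card (?f -` {0})"
    using mult_le_mono1[OF im, of "card (?f -` {0})"] eq by simp
  hence "q \<le> card (?f -` {0})" using q0 by simp
  with ker show ker_eq: "card (?f -` {0}) = q" by simp
  have "card (range ?f) = q ^ (n - 1)" using eq q0 unfolding ker_eq by simp
  thus "range ?f = ?K" using sub K by (intro card_seteq) auto
qed

lemma card_T1_power_diff_eq:
  "card {x::'a. T1 q n (x ^ (q + 1) - x ^ 2) = 0} = F q n (0::'a) 0 * q"
proof -
  let ?f = "\<lambda>x::'a. x ^ q - x" and ?S = "{a::'a. T1 q n a = 0 \<and> T2 q n a = 0}"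
  \<comment> \<open>On values of \<open>?f\<close> the condition on \<open>T1\<close> holds
    automatically, so only the one on \<open>T2\<close> remains.\<close>
  have "{x. T1 q n (x ^ (q + 1) - x ^ 2) = 0} = ?f -` ?S"
    by (auto simp only: vimage_def mem_Collect_eq T1_power_diff T2_power_diff)
  moreover have "?S \<subseteq> range ?f" using range_power_diff by auto
  ultimately show ?thesis
    using card_vimage_additive[of ?f ?S] power_diff_additive card_kernel_power_diff
    by (simp add: F_def)
qed

end

theorem proposition2:
  fixes p r q n :: nat
  assumes "prime p" and "r \<ge> 1" and "q = p ^ r" and "n \<ge> 1"
    and "CARD('a::finite_field) = q ^ n"
  shows "real (F q n (0::'a) 0)
    = 1 / real q * real (card {x::'a. T1 q n (x ^ (q + 1) - x ^ 2) = 0})"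
proof -
  have "CHAR('a) = p"
    using assms by (intro CHAR_eq_of_CARD_prime_power[of p "r * n"]) (simp_all add: power_mult)
  hence "card {x::'a. T1 q n (x ^ (q + 1) - x ^ 2) = 0} = F q n (0::'a) 0 * q"
    using assms by (intro card_T1_power_diff_eq[of q r n]) auto
  moreover have "q > 0" using assms by (simp add: prime_gt_0_nat)
  ultimately show ?thesis by simp
qed

end
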